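(* Let $f\in V^*$, $y\in\mathbf Q(f)$, let $\Phi$ be Hadamard directionally differentiable at $y$, and suppose that $\Phi'(y)\colon V\to V$ is Lipschitz with Lipschitz constant $C_L<C_a/C_b$. For $d\in V^*$ let $\alpha(d)\in V$ denote the solution of $$\alpha\in\mathcal K^y(\alpha):\quad\langle A\alpha-d,\,\alpha-v\rangle\le0\quad\forall v\in\mathcal K^y(\alpha),\qquad\mathcal K^y(w):=\Phi'(y)(w)+\mathcal T_{\mathbf K(y)}(y)\cap[f-Ay]^\perp .$$ Then $d\mapsto\alpha(d)$ is continuous from $V^*$ to $V$; that is, if $d_j\to d$ in $V^*$, then $\alpha(d_j)\to\alpha(d)$ in $V$.
   Context: $V$ is a real reflexive Banach space which is a vector lattice for the order $u\le v\iff v-u\in V_+$ induced by a closed convex cone $V_+$ with $V_+\cap(-V_+)=\{0\}$, and $v_n\to v$ in $V$ implies $\sup(0,v_n)\rightharpoonup\sup(0,v)$ in $V$. With $u^+:=\sup(0,u)$, $u^-:=u^+-u$, $A\colon V\to V^*$ is linear and $C_a,C_b>0$ are constants with $\langle Au,v\rangle\le C_b\|u\|_V\|v\|_V$, $\langle Au,u\rangle\ge C_a\|u\|_V^2$, $\langle Au^+,u^-\rangle\le0$ for all $u,v\in V$. $\Phi\colon V\to V$ is a given map. $\mathbf K(w):=\{v\in V:v\le\Phi(w)\}$. $\mathbf Q(f)$ is the set of all $y\in V$ with $y\in\mathbf K(y)$ and $\langle Ay-f,y-v\rangle\le0$ for all $v\in\mathbf K(y)$. $\mathcal T_{\mathbf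 K(y)}(y)$ is the closure in $V$ of the radial cone $\{h\in V:\exists s^*>0,\ y+sh\in\mathbf K(y)\ \forall s\in[0,s^*]\}$. $[g]^\perp:=\{v\in V:\langle g,v\rangle=0\}$. Hadamard directional differentiability at $y$ means: for every $h\in V$ there is $\Phi'(y)(h)\in V$ with $s^{-1}(\Phi(y+sh_s)-\Phi(y))\to\Phi'(y)(h)$ in $V$ as $s\to0^+$ whenever $h_s\to h$ in $V$. (Under the stated Lipschitz condition the quasi-variational inequality for $\alpha(d)$ has a unique solution.) *)

theory Defs
  imports "HOL-Analysis.Analysis"
begin

text \<open>
  The dual space of \<open>'v\<close> is \<open>'v \<Rightarrow>\<^sub>L real\<close> with the operator norm, and the duality
  pairing of \<open>g\<close> with \<open>v\<close> is \<open>blinfun_apply g v\<close>.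
\<close>

definition bidual_embedding ::
    "'v::real_normed_vector \<Rightarrow> (('v \<Rightarrow>\<^sub>L real) \<Rightarrow>\<^sub>L real)"
  where "bidual_embedding x = Blinfun (\<lambda>g. blinfun_apply g x)"

lemma bidual_embedding_apply [simp]:
  "blinfun_apply (bidual_embedding x) g = blinfun_apply g x"
  unfolding bidual_embedding_def
  by (simp add: bounded_linear_Blinfun_apply blinfun.bounded_linear_left)

definition reflexive_space :: "'v::real_normed_vector itself \<Rightarrow> bool"
  where "reflexive_space _ \<longleftrightarrow>
    surj (bidual_embedding :: 'v \<Rightarrow> (('v \<Rightarrow>\<^sub>L real) \<Rightarrow>\<^sub>L real))"

definition weakly_tendsto :: "(nat \<Rightarrow> 'v::real_normed_vector) \<Rightarrow> 'v \<Rightarrow> bool"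
  where "weakly_tendsto x l \<longleftrightarrow>
    (\<forall>g :: 'v \<Rightarrow>\<^sub>L real. (\<lambda>n. blinfun_apply g (x n)) \<longlonglongrightarrow> blinfun_apply g l)"

definition pos_part :: "'v::{zero,sup} \<Rightarrow> 'v"
  where "pos_part u = sup 0 u"

definition neg_part :: "'v::{zero,sup,minus} \<Rightarrow> 'v"
  where "neg_part u = pos_part u - u"

definition obstacle_set :: "('v::ord \<Rightarrow> 'v) \<Rightarrow> 'v \<Rightarrow> 'v set"
  where "obstacle_set \<Phi> w = {v. v \<le> \<Phi> w}"

text \<open>
  Solution set of the quasi-variational inequality with moving constraint set \<open>K\<close>
  and source term \<open>f\<close>.
\<close>

definition qvi_solutions ::
    "('v::real_normed_vector \<Rightarrow> ('v \<Rightarrow>\<^sub>L real)) \<Rightarrow> ('v \<Rightarrow> 'v set) \<Rightarrow> ('v \<Rightarrow>\<^sub>L real) \<Rightarrow> 'v set"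
  where "qvi_solutions A K f =
    {y. y \<in> K y \<and> (\<forall>v\<in>K y. blinfun_apply (A y - f) (y - v) \<le> 0)}"

definition radial_cone :: "'v::real_vector set \<Rightarrow> 'v \<Rightarrow> 'v set"
  where "radial_cone C y = {h. \<exists>s0>0. \<forall>s\<in>{0..s0}. y + s *\<^sub>R h \<in> C}"

definition tangent_cone :: "'v::real_normed_vector set \<Rightarrow> 'v \<Rightarrow> 'v set"
  where "tangent_cone C y = closure (radial_cone C y)"

definition annihilator :: "('v::real_normed_vector \<Rightarrow>\<^sub>L real) \<Rightarrow> 'v set"
  where "annihilator g = {v. blinfun_apply g v = 0}"

text \<open>
  \<open>\<Phi>'\<close> is the directional derivative \<open>h \<mapsto> \<Phi>'(y)(h)\<close> at the fixed point \<open>y\<close>; it need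
  not be linear. It is uniquely determined (take \<open>hs\<close> constant).
\<close>

definition has_hadamard_derivative ::
    "('v::real_normed_vector \<Rightarrow> 'v) \<Rightarrow> ('v \<Rightarrow> 'v) \<Rightarrow> 'v \<Rightarrow> bool"
  where "has_hadamard_derivative \<Phi> \<Phi>' y \<longleftrightarrow>
    (\<forall>h. \<forall>hs :: real \<Rightarrow> 'v. (hs \<longlongrightarrow> h) (at_right 0) \<longrightarrow>
      ((\<lambda>s. inverse s *\<^sub>R (\<Phi> (y + s *\<^sub>R hs s) - \<Phi> y)) \<longlongrightarrow> \<Phi>' h) (at_right 0))"

definition linearized_set ::
    "('v::{real_normed_vector,ord} \<Rightarrow> ('v \<Rightarrow>\<^sub>L real)) \<Rightarrow> ('v \<Rightarrow> 'v) \<Rightarrow> ('v \<Rightarrow> 'v) \<Rightarrow>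
      ('v \<Rightarrow>\<^sub>L real) \<Rightarrow> 'v \<Rightarrow> 'v \<Rightarrow> 'v set"
  where "linearized_set A \<Phi> \<Phi>' f y w =
    (\<lambda>t. \<Phi>' w + t) ` (tangent_cone (obstacle_set \<Phi> y) y \<inter> annihilator (f - A y))"

definition linearized_solution ::
    "('v::{real_normed_vector,ord} \<Rightarrow> ('v \<Rightarrow>\<^sub>L real)) \<Rightarrow> ('v \<Rightarrow> 'v) \<Rightarrow> ('v \<Rightarrow> 'v) \<Rightarrow>
      ('v \<Rightarrow>\<^sub>L real) \<Rightarrow> 'v \<Rightarrow> ('v \<Rightarrow>\<^sub>L real) \<Rightarrow> 'v"
  where "linearized_solution A \<Phi> \<Phi>' f y d =
    (THE a. a \<in> qvi_solutions A (linearized_set A \<Phi> \<Phi>' f y) d)"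

end

theory Submission
  imports Defs
begin

text \<open>
  Testing the inequalities of two solutions \<open>a\<^sub>i = \<Phi>' a\<^sub>i + t\<^sub>i\<close> against each other's \<open>t\<^sub>j\<close>
  gives \<open>\<langle>A (a\<^sub>1 - a\<^sub>2), t\<^sub>1 - t\<^sub>2\<rangle> \<le> \<langle>d\<^sub>1 - d\<^sub>2, t\<^sub>1 - t\<^sub>2\<rangle>\<close>, hence
  \<open>(C\<^sub>a - C\<^sub>b C\<^sub>L) \<parallel>a\<^sub>1 - a\<^sub>2\<parallel> \<le> (1 + C\<^sub>L) \<parallel>d\<^sub>1 - d\<^sub>2\<parallel>\<close>: the solution map is even Lipschitz. The same
  estimate makes the map sending \<open>w\<close> to the solution of the variational inequality on
  \<open>\<Phi>' w + T\<close> a contraction with constant \<open>C\<^sub>b C\<^sub>L / C\<^sub>a\<close>, whose fixed point is the solution of the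
  quasi-variational inequality. Variational inequalities are solved by minimizing a quadratic
  functional for the symmetric part of \<open>A\<close>, and then by switching on the skew part, which does
  not affect coercivity, in finitely many small steps.
\<close>

section \<open>Variational inequalities and comparison of their solutions\<close>

definition vi_solution ::
    "('v::real_vector \<Rightarrow> 'v \<Rightarrow> real) \<Rightarrow> ('v \<Rightarrow> real) \<Rightarrow> 'v set \<Rightarrow> 'v \<Rightarrow> bool"
  where "vi_solution a g K t \<longleftrightarrow> t \<in> K \<and> (\<forall>v\<in>K. a t (t - v) \<le> g (t - v))"

text \<open>As the shifts may differ, \<open>z2\<close> need not be admissible for the first
  problem, nor \<open>z1\<close> for the second. Only the components in \<open>T\<close> are
  exchanged: \<open>p1 + t2\<close> and \<open>p2 + t1\<close> serve as test points.\<close>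

lemma vi_solution_translates_diff:
  assumes a: "bounded_bilinear a"
    and g: "linear g1" "linear g2"
    and z1: "vi_solution a g1 ((+) p1 ` T) z1"
    and z2: "vi_solution a g2 ((+) p2 ` T) z2"
  shows "a (z1 - z2) (z1 - z2 - (p1 - p2)) \<le> g1 (z1 - z2 - (p1 - p2)) - g2 (z1 - z2 - (p1 - p2))"
proof -
  interpret a: bounded_bilinear a by (fact a)
  obtain t1 t2 where t: "t1 \<in> T" "z1 = p1 + t1" "t2 \<in> T" "z2 = p2 + t2"
    using z1 z2 unfolding vi_solution_def by blast
  have "a z1 (z1 - (p1 + t2)) \<le> g1 (z1 - (p1 + t2))"
    using z1 t unfolding vi_solution_def by blast
  then have 1: "a z1 (t1 - t2) \<le> g1 (t1 - t2)" using t by simp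
  have "a z2 (z2 - (p2 + t1)) \<le> g2 (z2 - (p2 + t1))"
    using z2 t unfolding vi_solution_def by blast
  then have 2: "a z2 (t2 - t1) \<le> g2 (t2 - t1)" using t by simp
  have "z1 - z2 - (p1 - p2) = t1 - t2" using t by simp
  then show ?thesis
    using 1 2 linear_diff[OF g(1)] linear_diff[OF g(2)] by (simp add: a.diff_left a.diff_right)
qed

lemma vi_solution_diff:
  assumes "bounded_bilinear a" "linear g1" "linear g2"
    and "vi_solution a g1 K z1" "vi_solution a g2 K z2"
  shows "a (z1 - z2) (z1 - z2) \<le> g1 (z1 - z2) - g2 (z1 - z2)"
  using vi_solution_translates_diff[of a g1 g2 0 K z1 0 z2] assms by simp

section \<open>Existence for coercive variational inequalities\<close>

text \<open>The solution is the minimizer over \<open>K\<close> of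
  \<open>J u = a u u - 2 * g u\<close>. Coercivity makes minimizing sequences Cauchy, and symmetry
  turns the first-order condition at the minimizer into the inequality.\<close>

lemma vi_solution_symmetric:
  fixes a :: "'v::banach \<Rightarrow> 'v \<Rightarrow> real"
  assumes a: "bounded_bilinear a"
    and sym: "\<And>u v. a u v = a v u"
    and c: "c > 0" and coercive: "\<And>u. c * (norm u)\<^sup>2 \<le> a u u"
    and g: "bounded_linear g"
    and K: "closed K" "convex K" "K \<noteq> {}"
  shows "\<exists>t. vi_solution a g K t"
proof -
  interpret a: bounded_bilinear a by (fact a)
  interpret g: bounded_linear g by (fact g)
  define J where "J u = a u u - 2 * g u" for u
  obtain G where G: "\<And>x. \<bar>g x\<bar> \<le> norm x * G"
    using g.bounded by (auto simp: real_norm_def)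
  have J_lower: "- (G\<^sup>2 / c) \<le> J u" for u
  proof -
    have "0 \<le> (c * norm u - G)\<^sup>2 / c" using c by simp
    also have "\<dots> = c * (norm u)\<^sup>2 - 2 * (norm u * G) + G\<^sup>2 / c"
      using c by (simp add: power2_eq_square field_simps)
    also have "\<dots> \<le> J u + G\<^sup>2 / c"
      using coercive[of u] G[of u] unfolding J_def by linarith
    finally show ?thesis by simp
  qed
  then have bdd: "bdd_below (J ` K)" by (intro bdd_belowI2)
  define m where "m = Inf (J ` K)"
  have m_le: "m \<le> J u" if "u \<in> K" for u
    unfolding m_def using that bdd by (simp add: cInf_lower)
  have "\<exists>u\<in>K. J u < m + 1 / real (Suc n)" for n
  proof -
    have "Inf (J ` K) < m + 1 / real (Suc n)" unfolding m_def by simp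
    then show ?thesis using K(3) bdd by (subst (asm) cInf_less_iff) auto
  qed
  then obtain x where x: "\<And>n. x n \<in> K" "\<And>n. J (x n) < m + 1 / real (Suc n)" by metis
  \<comment> \<open>The midpoint lies in \<open>K\<close>, so its value is at least
    \<open>m\<close>; coercivity converts the remaining gap into a distance.\<close>
  have parallelogram: "c * (norm (u - v))\<^sup>2 \<le> 2 * J u + 2 * J v - 4 * m" if "u \<in> K" "v \<in> K" for u v
  proof -
    have "(1/2) *\<^sub>R u + (1/2) *\<^sub>R v \<in> K" using K(2) that by (intro convexD) auto
    then have "m \<le> J ((1/2) *\<^sub>R u + (1/2) *\<^sub>R v)" by (rule m_le)
    also have "\<dots> = J u / 2 + J v / 2 - a (u - v) (u - v) / 4"
      unfolding J_def using sym[of v u]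
      by (simp add: a.add_left a.add_right a.diff_left a.diff_right a.scaleR_left a.scaleR_right
          g.add g.scaleR field_simps)
    finally show ?thesis using coercive[of "u - v"] by simp
  qed
  have "Cauchy x"
  proof (rule metric_CauchyI)
    fix e :: real assume e: "e > 0"
    \<comment> \<open>Two points with excess below \<open>c * e\<^sup>2 / 4\<close> over
      \<open>m\<close> make the right-hand side of \<open>parallelogram\<close> smaller than
      \<open>c * e\<^sup>2\<close>.\<close>
    then obtain N where N: "inverse (real (Suc N)) < c * e\<^sup>2 / 4"
      using reals_Archimedean[of "c * e\<^sup>2 / 4"] c by auto
    show "\<exists>M. \<forall>k\<ge>M. \<forall>n\<ge>M. dist (x k) (x n) < e"
    proof (intro exI[of _ N] allI impI)
      fix k n assume kn: "k \<ge> N" "n \<ge> N"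
      have small: "J (x i) < m + c * e\<^sup>2 / 4" if "i \<ge> N" for i
      proof -
        have "1 / real (Suc i) \<le> inverse (real (Suc N))" using that by (simp add: field_simps)
        then show ?thesis using x(2)[of i] N by linarith
      qed
      have "c * (norm (x k - x n))\<^sup>2 < c * e\<^sup>2"
        using parallelogram[OF x(1) x(1), of k n] small[OF kn(1)] small[OF kn(2)] by linarith
      then have "(norm (x k - x n))\<^sup>2 < e\<^sup>2" using c by simp
      then show "dist (x k) (x n) < e"
        using e by (simp add: dist_norm power_less_imp_less_base)
    qed
  qed
  then obtain t where t: "x \<longlonglongrightarrow> t" using Cauchy_convergent_iff convergent_def by blast
  have tK: "t \<in> K" using closed_sequentially[OF K(1) _ t] x(1) by blast
  have "(\<lambda>n. J (x n)) \<longlonglongrightarrow> J t"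
    unfolding J_def by (intro tendsto_intros a.tendsto g.tendsto t)
  moreover have "(\<lambda>n. m + 1 / real (Suc n)) \<longlonglongrightarrow> m + 0"
    using LIMSEQ_inverse_real_of_nat by (intro tendsto_intros) (simp add: inverse_eq_divide)
  ultimately have "J t \<le> m + 0"
    by (rule LIMSEQ_le) (use x(2) less_imp_le in blast)
  then have J_min: "J t \<le> J v" if "v \<in> K" for v using m_le[OF that] by simp
  have J_shift: "J (t - s *\<^sub>R h) = J t - s * (2 * (a t h - g h) - s * a h h)" for s h
    unfolding J_def using sym[of h t]
    by (simp add: a.diff_left a.diff_right a.scaleR_left a.scaleR_right g.diff g.scaleR algebra_simps)
  have "a t (t - v) \<le> g (t - v)" if v: "v \<in> K" for v
  proof -
    \<comment> \<open>Minimality is tested along the segment from \<open>t\<close> to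
      \<open>v\<close> and divided by \<open>s\<close>; the quadratic remainder then vanishes as
      \<open>s\<close> tends to 0.\<close>
    have variation: "2 * (a t (t - v) - g (t - v)) \<le> s * a (t - v) (t - v)" if s: "0 < s" "s < 1" for s
    proof -
      have "(1 - s) *\<^sub>R t + s *\<^sub>R v \<in> K" using K(2) tK v s by (intro convexD) auto
      then have "t - s *\<^sub>R (t - v) \<in> K" by (simp add: algebra_simps)
      then have "J t \<le> J (t - s *\<^sub>R (t - v))" by (rule J_min)
      also have "\<dots> = J t - s * (2 * (a t (t - v) - g (t - v)) - s * a (t - v) (t - v))"
        by (simp add: J_shift)
      finally show ?thesis using s by (simp add: mult_le_0_iff)
    qed
    have "((\<lambda>s. s * a (t - v) (t - v)) \<longlongrightarrow> 0 * a (t - v) (t - v)) (at_right 0)"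
      by (intro tendsto_intros)
    moreover have "eventually (\<lambda>s. 2 * (a t (t - v) - g (t - v)) \<le> s * a (t - v) (t - v)) (at_right 0)"
      using variation by (intro eventually_at_rightI[of 0 1]) auto
    ultimately have "2 * (a t (t - v) - g (t - v)) \<le> 0 * a (t - v) (t - v)"
      by (rule tendsto_lowerbound) simp
    then show ?thesis by simp
  qed
  with tK show ?thesis unfolding vi_solution_def by blast
qed

lemma vi_solution_perturb:
  fixes a b :: "'v::banach \<Rightarrow> 'v \<Rightarrow> real"
  assumes a: "bounded_bilinear a" and b: "bounded_bilinear b"
    and coercive: "\<And>u. c * (norm u)\<^sup>2 \<le> a u u"
    and b_bound: "\<And>u v. \<bar>b u v\<bar> \<le> M * norm u * norm v"
    and M: "0 \<le> M" "M < c"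
    and solvable: "\<And>g. bounded_linear g \<Longrightarrow> \<exists>t. vi_solution a g K t"
    and g: "bounded_linear g"
  shows "\<exists>t. vi_solution (\<lambda>u v. a u v + b u v) g K t"
proof -
  interpret a: bounded_bilinear a by (fact a)
  interpret b: bounded_bilinear b by (fact b)
  define h where "h w v = g v - b w v" for w v
  have h: "bounded_linear (h w)" for w
    unfolding h_def by (intro bounded_linear_sub g b.bounded_linear_right)
  then have h_lin: "linear (h w)" for w by (rule bounded_linear.linear)
  obtain F where F: "\<And>w. vi_solution a (h w) K (F w)"
    using solvable[OF h] by metis
  have "dist (F w1) (F w2) \<le> M / c * dist w1 w2" for w1 w2
  proof -
    define z where "z = F w1 - F w2"
    have "c * (norm z)\<^sup>2 \<le> a z z" by (rule coercive)
    also have "\<dots> \<le> h w1 z - h w2 z"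
      unfolding z_def by (rule vi_solution_diff[OF a h_lin h_lin F F])
    also have "\<dots> \<le> M * norm (w1 - w2) * norm z"
      using b_bound[of "w1 - w2" z] by (simp add: h_def b.diff_left)
    finally have "norm z * (c * norm z) \<le> norm z * (M * norm (w1 - w2))"
      by (simp add: power2_eq_square algebra_simps)
    then have "c * norm z \<le> M * norm (w1 - w2)"
      using M by (cases "norm z = 0") auto
    then show ?thesis using M by (simp add: z_def dist_norm field_simps)
  qed
  then obtain t where "F t = t"
    using banach_fix_type[of "M / c" F] M by auto
  then have "vi_solution a (h t) K t" using F[of t] by simp
  then show ?thesis unfolding vi_solution_def h_def
    by (intro exI[of _ t]) (auto simp: le_diff_eq)
qed

text \<open>The forms \<open>ak k\<close> lead from the symmetric part of \<open>a\<close> at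
  \<open>k = 0\<close> to \<open>a\<close> itself at \<open>k = N\<close>; induction on
  \<open>k\<close> carries solvability along.\<close>

lemma lions_stampacchia:
  fixes a :: "'v::banach \<Rightarrow> 'v \<Rightarrow> real"
  assumes a: "bounded_bilinear a"
    and c: "c > 0" and coercive: "\<And>u. c * (norm u)\<^sup>2 \<le> a u u"
    and g: "bounded_linear g"
    and K: "closed K" "convex K" "K \<noteq> {}"
  shows "\<exists>t. vi_solution a g K t"
proof -
  interpret a: bounded_bilinear a by (fact a)
  obtain M where M: "M \<ge> 0" "\<And>u v. \<bar>a u v\<bar> \<le> norm u * norm v * M"
    using a.nonneg_bounded by (auto simp: real_norm_def)
  \<comment> \<open>Each step adds \<open>skew (1 / real N)\<close>, bounded by
    \<open>M / N\<close>; this choice makes that smaller than \<open>c\<close>, as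
    \<open>vi_solution_perturb\<close> requires.\<close>
  obtain N :: nat where N: "M / c < real N" using reals_Archimedean2 by blast
  then have N_pos: "real N > 0" using M(1) c by (smt (verit) divide_nonneg_pos)
  define skew where "skew r u v = r * ((a u v - a v u) / 2)" for r u v
  define ak where "ak k u v = (a u v + a v u) / 2 + skew (real k / real N) u v" for k u v
  have skew_bound: "\<bar>skew r u v\<bar> \<le> (\<bar>r\<bar> * M) * norm u * norm v" for r u v
  proof -
    have "\<bar>(a u v - a v u) / 2\<bar> \<le> norm u * norm v * M"
      using M(2)[of u v] M(2)[of v u] by (simp add: mult.commute mult.left_commute abs_le_iff)
    then have "\<bar>r\<bar> * \<bar>(a u v - a v u) / 2\<bar> \<le> \<bar>r\<bar> * (norm u * norm v * M)"
      by (intro mult_left_mono) auto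
    then show ?thesis by (simp add: skew_def abs_mult mult_ac)
  qed
  have skew: "bounded_bilinear (skew r)" for r
  proof
    show "\<exists>L. \<forall>u v. norm (skew r u v) \<le> norm u * norm v * L"
      using skew_bound[of r] by (intro exI[of _ "\<bar>r\<bar> * M"]) (simp add: mult_ac)
  qed (auto simp: skew_def a.add_left a.add_right a.scaleR_left a.scaleR_right field_simps)
  have bilinear: "bounded_bilinear (ak k)" for k
  proof
    interpret s: bounded_bilinear "skew (real k / real N)" by (rule skew)
    have "norm (ak k u v) \<le> norm u * norm v * (M + \<bar>real k / real N\<bar> * M)" for u v
    proof -
      have "\<bar>(a u v + a v u) / 2\<bar> \<le> norm u * norm v * M"
        using M(2)[of u v] M(2)[of v u] by (simp add: mult.commute mult.left_commute abs_le_iff)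
      then show ?thesis
        using skew_bound[of "real k / real N" u v]
          abs_triangle_ineq[of "(a u v + a v u) / 2" "skew (real k / real N) u v"]
        unfolding ak_def real_norm_def by (simp only: distrib_left mult_ac)
    qed
    then show "\<exists>L. \<forall>u v. norm (ak k u v) \<le> norm u * norm v * L" by blast
    show "ak k (u + u') v = ak k u v + ak k u' v" "ak k v (u + u') = ak k v u + ak k v u'" for u u' v
      unfolding ak_def a.add_left a.add_right s.add_left s.add_right by (simp_all add: field_simps)
    show "ak k (r *\<^sub>R u) v = r *\<^sub>R ak k u v" "ak k u (r *\<^sub>R v) = r *\<^sub>R ak k u v" for r u v
      unfolding ak_def a.scaleR_left a.scaleR_right s.scaleR_left s.scaleR_right
      by (simp_all add: field_simps)
  qed
  \<comment> \<open>The skew part vanishes on the diagonal, so one constant \<open>c\<close> serves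
    every step and \<open>N\<close> can be fixed beforehand.\<close>
  have coercive_k: "c * (norm u)\<^sup>2 \<le> ak k u u" for k u
    using coercive[of u] by (simp add: ak_def skew_def)
  have "\<exists>t. vi_solution (ak k) g K t" if "bounded_linear g" for k g
    using that
  proof (induction k arbitrary: g)
    case 0
    show ?case
      by (rule vi_solution_symmetric[OF bilinear _ c coercive_k 0 K]) (simp add: ak_def skew_def)
  next
    case (Suc k)
    have "ak (Suc k) = (\<lambda>u v. ak k u v + skew (1 / real N) u v)"
      by (intro ext) (simp add: ak_def skew_def add_divide_distrib distrib_right)
    moreover have "\<bar>1 / real N\<bar> * M < c"
      using N N_pos c by (simp add: field_simps)
    ultimately show ?case
      using vi_solution_perturb[OF bilinear skew coercive_k skew_bound _ _ Suc.IH Suc.prems, of "1 / real N"]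
        M(1) by simp
  qed
  moreover have "ak N = a"
    using N_pos by (intro ext) (simp add: ak_def skew_def field_simps)
  ultimately show ?thesis using g by metis
qed

section \<open>Quasi-variational inequalities on Lipschitz translates of a fixed set\<close>

text \<open>Splitting \<open>a z z\<close> into \<open>a z (z - q)\<close> and \<open>a z q\<close>
  bounds the first term by the data and the second by \<open>M * L * (norm z)\<^sup>2\<close>, which
  coercivity absorbs when \<open>M * L < c\<close>. Equal data then give uniqueness, different data
  give stability.\<close>

lemma qvi_translates_diff_le:
  fixes a :: "'v::real_normed_vector \<Rightarrow> 'v \<Rightarrow> real"
  assumes a: "bounded_bilinear a"
    and coercive: "\<And>u. c * (norm u)\<^sup>2 \<le> a u u"
    and a_bound: "\<And>u v. a u v \<le> M * norm u * norm v"
    and M: "0 \<le> M" and lip: "L-lipschitz_on UNIV p"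
    and z1: "vi_solution a (blinfun_apply d1) ((+) (p z1) ` T) z1"
    and z2: "vi_solution a (blinfun_apply d2) ((+) (p z2) ` T) z2"
  shows "(c - M * L) * norm (z1 - z2) \<le> (1 + L) * norm (d1 - d2)"
proof -
  interpret a: bounded_bilinear a by (fact a)
  define z where "z = z1 - z2"
  define q where "q = p z1 - p z2"
  have L: "0 \<le> L" using lip by (rule lipschitz_on_nonneg)
  have q: "norm q \<le> L * norm z"
    using lipschitz_onD[OF lip, of z1 z2] by (simp add: q_def z_def dist_norm)
  have "a z (z - q) \<le> blinfun_apply (d1 - d2) (z - q)"
    using vi_solution_translates_diff[OF a _ _ z1 z2]
    by (simp add: z_def q_def bounded_linear.linear[OF blinfun.bounded_linear_right] blinfun.diff_left)
  also have "\<dots> \<le> norm (d1 - d2) * norm (z - q)"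
    using norm_blinfun[of "d1 - d2" "z - q"] by simp
  also have "\<dots> \<le> norm (d1 - d2) * ((1 + L) * norm z)"
    using norm_triangle_ineq4[of z q] q by (intro mult_left_mono) (auto simp: algebra_simps)
  finally have "a z (z - q) \<le> norm (d1 - d2) * ((1 + L) * norm z)" .
  moreover have "a z q \<le> M * norm z * (L * norm z)"
    using a_bound[of z q] mult_left_mono[OF q, of "M * norm z"] M by simp
  ultimately have "norm z * ((c - M * L) * norm z) \<le> norm z * ((1 + L) * norm (d1 - d2))"
    using coercive[of z] by (simp add: a.diff_right power2_eq_square algebra_simps)
  \<comment> \<open>If \<open>norm z = 0\<close> nothing can be cancelled, but the left side is 0
    and the right side is nonnegative since \<open>0 \<le> L\<close>.\<close>
  then show ?thesis
    using L by (cases "norm z = 0") (auto simp: z_def)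
qed

text \<open>For a frozen shift \<open>p w\<close> the set is fixed, closed and convex, so
  \<open>lions_stampacchia\<close> applies. Comparing two such solutions with the same
  \<open>g\<close> leaves only the shift term, whence the contraction constant
  \<open>M * L / c\<close>.\<close>

lemma qvi_translates_exists:
  fixes a :: "'v::banach \<Rightarrow> 'v \<Rightarrow> real"
  assumes a: "bounded_bilinear a"
    and c: "c > 0" and coercive: "\<And>u. c * (norm u)\<^sup>2 \<le> a u u"
    and a_bound: "\<And>u v. a u v \<le> M * norm u * norm v"
    and M: "0 \<le> M" and lip: "L-lipschitz_on UNIV p" and small: "M * L < c"
    and g: "bounded_linear g"
    and T: "closed T" "convex T" "T \<noteq> {}"
  shows "\<exists>z. vi_solution a g ((+) (p z) ` T) z"
proof -
  interpret a: bounded_bilinear a by (fact a)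
  have L: "0 \<le> L" using lip by (rule lipschitz_on_nonneg)
  have "\<exists>z. vi_solution a g ((+) (p w) ` T) z" for w
    using T by (intro lions_stampacchia[OF a c coercive g])
      (auto intro: closed_translation convex_translation)
  then obtain F where F: "\<And>w. vi_solution a g ((+) (p w) ` T) (F w)"
    by atomize_elim (intro choice allI)
  have "dist (F w1) (F w2) \<le> M * L / c * dist w1 w2" for w1 w2
  proof -
    define z where "z = F w1 - F w2"
    have "a z (z - (p w1 - p w2)) \<le> 0"
      using vi_solution_translates_diff[OF a _ _ F F] g
      by (simp add: z_def bounded_linear.linear)
    then have "c * (norm z)\<^sup>2 \<le> M * norm z * norm (p w1 - p w2)"
      using coercive[of z] a_bound[of z "p w1 - p w2"] by (simp add: a.diff_right)
    also have "\<dots> \<le> M * norm z * (L * norm (w1 - w2))"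
      using lipschitz_onD[OF lip, of w1 w2] M by (intro mult_left_mono) (auto simp: dist_norm)
    finally have "norm z * (c * norm z) \<le> norm z * (M * L * norm (w1 - w2))"
      by (simp add: power2_eq_square algebra_simps)
    then have "c * norm z \<le> M * L * norm (w1 - w2)"
      using M L by (cases "norm z = 0") auto
    then show ?thesis using c by (simp add: z_def dist_norm field_simps)
  qed
  then obtain z where "F z = z"
    using banach_fix_type[of "M * L / c" F] M L small c by auto
  then show ?thesis using F by metis
qed

section \<open>The critical cone and the linearized problem\<close>

lemma convex_radial_cone:
  assumes "convex C"
  shows "convex (radial_cone C y)"
proof (rule convexI)
  fix h k and u v :: real
  assume hk: "h \<in> radial_cone C y" "k \<in> radial_cone C y" and uv: "0 \<le> u" "0 \<le> v" "u + v = 1"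
  obtain s1 s2 where s: "s1 > 0" "\<forall>s\<in>{0..s1}. y + s *\<^sub>R h \<in> C" "s2 > 0" "\<forall>s\<in>{0..s2}. y + s *\<^sub>R k \<in> C"
    using hk unfolding radial_cone_def by blast
  have "y + s *\<^sub>R (u *\<^sub>R h + v *\<^sub>R k) \<in> C" if "s \<in> {0..min s1 s2}" for s
  proof -
    have "u *\<^sub>R (y + s *\<^sub>R h) + v *\<^sub>R (y + s *\<^sub>R k) \<in> C"
      using s that uv by (intro convexD[OF assms]) auto
    also have "u *\<^sub>R (y + s *\<^sub>R h) + v *\<^sub>R (y + s *\<^sub>R k) = (u + v) *\<^sub>R y + s *\<^sub>R (u *\<^sub>R h + v *\<^sub>R k)"
      by (simp add: algebra_simps)
    finally show ?thesis using uv by simp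
  qed
  then show "u *\<^sub>R h + v *\<^sub>R k \<in> radial_cone C y"
    unfolding radial_cone_def using s by (auto intro!: exI[of _ "min s1 s2"])
qed

theorem proposition3p12:
  fixes V_pos :: "'v::{banach,lattice} set"
    and A :: "'v \<Rightarrow> ('v \<Rightarrow>\<^sub>L real)"
    and C_a C_b C_L :: real
    and \<Phi> \<Phi>' :: "'v \<Rightarrow> 'v"
    and f :: "'v \<Rightarrow>\<^sub>L real"
    and y :: 'v
  assumes reflexive: "reflexive_space TYPE('v)"
    and cone: "closed V_pos" "convex V_pos" "cone V_pos" "V_pos \<inter> uminus ` V_pos = {0}"
    and order: "\<And>u v :: 'v. u \<le> v \<longleftrightarrow> v - u \<in> V_pos"
    and sup_cont: "\<And>(v :: nat \<Rightarrow> 'v) l. v \<longlonglongrightarrow> l \<Longrightarrow>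
      weakly_tendsto (\<lambda>n. sup 0 (v n)) (sup 0 l)"
    and constants_pos: "C_a > 0" "C_b > 0"
    and A_linear: "linear A"
    and A_bounded: "\<And>u v. blinfun_apply (A u) v \<le> C_b * norm u * norm v"
    and A_coercive: "\<And>u. blinfun_apply (A u) u \<ge> C_a * (norm u)\<^sup>2"
    and A_T_monotone: "\<And>u. blinfun_apply (A (pos_part u)) (neg_part u) \<le> 0"
    and y: "y \<in> qvi_solutions A (obstacle_set \<Phi>) f"
    and deriv: "has_hadamard_derivative \<Phi> \<Phi>' y"
    and lipschitz: "C_L-lipschitz_on UNIV \<Phi>'" "C_L < C_a / C_b"
  shows "(\<forall>d. \<exists>!a. a \<in> qvi_solutions A (linearized_set A \<Phi> \<Phi>' f y) d) \<and>
    continuous_on UNIV (linearized_solution A \<Phi> \<Phi>' f y)"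
proof -
  \<comment> \<open>This is the critical cone; \<open>linearized_set\<close> at \<open>w\<close> is
    its translate by \<open>\<Phi>' w\<close>, which puts the problem in the form treated
    above.\<close>
  define T where "T = tangent_cone (obstacle_set \<Phi> y) y \<inter> annihilator (f - A y)"
  define a where "a u v = blinfun_apply (A u) v" for u v
  define sol where "sol d z \<longleftrightarrow> vi_solution a (blinfun_apply d) ((+) (\<Phi>' z) ` T) z" for d z
  interpret A: linear A by (fact A_linear)
  have a: "bounded_bilinear a"
  proof
    \<comment> \<open>The one-sided bound at \<open>v\<close> and at \<open>- v\<close> yields the
      absolute value.\<close>
    have "\<bar>blinfun_apply (A u) v\<bar> \<le> norm u * norm v * C_b" for u v
      using A_bounded[of u v] A_bounded[of u "- v"]
      by (simp add: abs_le_iff blinfun.minus_right mult_ac)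
    then show "\<exists>K. \<forall>u v. norm (a u v) \<le> norm u * norm v * K"
      unfolding a_def real_norm_def by blast
  qed (simp_all add: a_def A.add A.scaleR blinfun.bilinear_simps)
  have coercive: "\<And>u. C_a * (norm u)\<^sup>2 \<le> a u u" unfolding a_def by (rule A_coercive)
  have a_bound: "\<And>u v. a u v \<le> C_b * norm u * norm v" unfolding a_def by (rule A_bounded)
  have small: "C_b * C_L < C_a" using lipschitz(2) constants_pos by (simp add: field_simps)

  \<comment> \<open>The obstacle set is a reflected and shifted copy of \<open>V_pos\<close> and
    inherits its convexity, which passes to the radial cone and its closure.\<close>
  have "obstacle_set \<Phi> y = (\<lambda>v. \<Phi> y + (-1) *\<^sub>R v) ` V_pos"
    by (force simp: obstacle_set_def order image_iff)
  then have "convex (obstacle_set \<Phi> y)" using convex_affinity[OF cone(2)] by metis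
  then have "convex T"
    unfolding T_def tangent_cone_def annihilator_def
    by (intro convex_Int convex_closure convex_radial_cone)
      (auto intro!: convexI simp: blinfun.bilinear_simps)
  moreover have "closed T"
    unfolding T_def tangent_cone_def annihilator_def
    by (intro closed_Int closed_closure closed_Collect_eq continuous_intros)
  moreover have "0 \<in> T"
  proof -
    have "y \<in> obstacle_set \<Phi> y" using y unfolding qvi_solutions_def by blast
    then have "0 \<in> radial_cone (obstacle_set \<Phi> y) y"
      unfolding radial_cone_def by (auto intro: exI[of _ 1])
    then show ?thesis
      using closure_subset unfolding T_def tangent_cone_def annihilator_def by (auto simp: blinfun.zero_right)
  qed
  ultimately have ex: "\<exists>z. sol d z" for d
    unfolding sol_def
    by (intro qvi_translates_exists[OF a constants_pos(1) coercive a_bound _ lipschitz(1) small])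
      (use constants_pos in \<open>auto intro: blinfun.bounded_linear_right\<close>)
  have stable: "(C_a - C_b * C_L) * norm (z1 - z2) \<le> (1 + C_L) * norm (d1 - d2)"
    if "sol d1 z1" "sol d2 z2" for d1 d2 z1 z2
    using qvi_translates_diff_le[OF a coercive a_bound _ lipschitz(1)] that constants_pos
    unfolding sol_def by (simp add: less_imp_le)
  \<comment> \<open>With equal data the right side of \<open>stable\<close> is 0, while
    \<open>small\<close> makes the factor on the left positive.\<close>
  have unique: "\<exists>!z. sol d z" for d
    using ex stable[of d _ d] small by (auto simp: mult_le_0_iff)
  have sol_iff: "z \<in> qvi_solutions A (linearized_set A \<Phi> \<Phi>' f y) d \<longleftrightarrow> sol d z" for d z
    unfolding qvi_solutions_def linearized_set_def sol_def vi_solution_def a_def T_def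
    by (simp add: blinfun.diff_left)
  have "linearized_solution A \<Phi> \<Phi>' f y d = (THE z. sol d z)" for d
    unfolding linearized_solution_def sol_iff ..
  \<comment> \<open>Unique existence ensures that the definite description in
    \<open>linearized_solution\<close> denotes an actual solution.\<close>
  then have sol: "sol d (linearized_solution A \<Phi> \<Phi>' f y d)" for d
    using theI'[OF unique] by simp
  have "((1 + C_L) / (C_a - C_b * C_L))-lipschitz_on UNIV (linearized_solution A \<Phi> \<Phi>' f y)"
    using stable[OF sol sol] small lipschitz_on_nonneg[OF lipschitz(1)]
    by (intro lipschitz_onI) (auto simp: dist_norm field_simps)
  then show ?thesis
    using unique sol_iff lipschitz_on_continuous_on by auto
qed

end
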